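(* For all integers $n \geq 1$, \[ |Av_n(3412,4321)| = |Av_n(3412,4231,45321,54312)|. \]
   Context: A permutation $p = p_1 p_2 \cdots p_n$ of $\{1,\dots,n\}$ (one-line notation) contains a pattern $q = q_1 \cdots q_k$ (a permutation of $\{1,\dots,k\}$ in one-line notation) if there are positions $n_1 < n_2 < \cdots < n_k$ such that, for all $i,j$, $p_{n_i} < p_{n_j}$ if and only if $q_i < q_j$. If $p$ does not contain $q$, then $p$ avoids $q$. For a set $S$ of patterns, $Av_n(S)$ denotes the set of permutations of $\{1,\dots,n\}$ that avoid every pattern in $S$; braces around the listed patterns are omitted. *)

theory Defs
  imports "HOL-Combinatorics.Multiset_Permutations"
begin

(* A permutation of {1..n} in one-line notation p_1 p_2 ... p_n is an element of
   permutations_of_set {1..n}.  List positions are counted from 0, so p_i is p ! (i - 1);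
   the function f lists the positions n_1 < ... < n_k of an occurrence of q in p. *)

definition contains_pattern :: "nat list \<Rightarrow> nat list \<Rightarrow> bool" where
  "contains_pattern p q \<longleftrightarrow>
     (\<exists>f :: nat \<Rightarrow> nat.
        strict_mono_on {..<length q} f \<and>
        (\<forall>i<length q. f i < length p) \<and>
        (\<forall>i<length q. \<forall>j<length q. p ! f i < p ! f j \<longleftrightarrow> q ! i < q ! j))"

definition Av :: "nat \<Rightarrow> nat list set \<Rightarrow> nat list set" where
  "Av n S = {p \<in> permutations_of_set {1..n}. \<forall>q\<in>S. \<not> contains_pattern p q}"

end

theory Submission
  imports Defs "HOL-Library.Sublist"
begin

text \<open>
Both classes are generated by appending a new last entry \<open>v\<close> and raising the old entries \<open>\<ge> v\<close>
by one.  Whether \<open>v\<close> is admissible depends only on which short patterns occur among the entries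
above or across the gap below \<open>v\<close>, and these data evolve deterministically under insertion.  The gaps
\<open>n\<close> and \<open>n + 1\<close> are always admissible.  The lower admissible gaps fall into a few state types, and
to every such gap one attaches as weight the number of lower admissible gaps that survive its use.  In each
type the number of descendants after \<open>t\<close> insertions turns out to be an affine function of the number of
lower admissible gaps and of their total weight.  The coefficients obey linear recurrences, and for
the permutation \<open>1\<close> both classes give \<open>1 + (1 + 4 + \<dots> + 4 ^ (t - 1))\<close>.
\<close>

section \<open>Appending a last entry, and subsequences of the result\<close>

definition shift :: "nat \<Rightarrow> nat \<Rightarrow> nat" where
  "shift v x = (if v \<le> x then Suc x else x)"

definition insert_last :: "nat \<Rightarrow> nat list \<Rightarrow> nat list" where
  "insert_last v p = map (shift v) p @ [v]"

lemma shift_less_iff [simp]: "shift v x < shift v y \<longleftrightarrow> x < y"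
  by (auto simp: shift_def)

lemma shift_eq_iff [simp]: "shift v x = shift v y \<longleftrightarrow> x = y"
  by (auto simp: shift_def)

lemma shift_less_self [simp]: "shift v x < v \<longleftrightarrow> x < v"
  by (auto simp: shift_def)

lemma self_less_shift [simp]: "v < shift v x \<longleftrightarrow> v \<le> x"
  by (auto simp: shift_def)

lemma shift_neq_self [simp]: "shift v x \<noteq> v" "v \<noteq> shift v x"
  by (auto simp: shift_def)

lemma le_shift_iff [simp]: "g \<le> v \<Longrightarrow> g \<le> shift v x \<longleftrightarrow> g \<le> x"
  "v \<le> g \<Longrightarrow> Suc g \<le> shift v x \<longleftrightarrow> g \<le> x"
  by (auto simp: shift_def)

lemma shift_less_iff_less [simp]: "g \<le> v \<Longrightarrow> shift v x < g \<longleftrightarrow> x < g"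
  "v \<le> g \<Longrightarrow> shift v x < Suc g \<longleftrightarrow> x < g"
  by (auto simp: shift_def)

lemma length_insert_last [simp]: "length (insert_last v p) = Suc (length p)"
  by (simp add: insert_last_def)

text \<open>\<open>list_emb\<close> recurses at the first entry, whereas insertion acts at the last
  one; this is the recursion from the right.\<close>

lemma subseq_snoc_snoc:
  "subseq (xs @ [x]) (ys @ [y]) \<longleftrightarrow> x = y \<and> subseq xs ys \<or> subseq (xs @ [x]) ys"
proof
  assume "subseq (xs @ [x]) (ys @ [y])"
  then obtain us vs where uv: "xs @ [x] = us @ vs" "subseq us ys" "subseq vs [y]"
    by (auto simp: subseq_append_iff[of _ ys])
  show "x = y \<and> subseq xs ys \<or> subseq (xs @ [x]) ys"
  proof (cases vs rule: rev_cases)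
    case (snoc ws w)
    with uv have "ws = []" "w = y"
      by (cases ws; auto split: if_splits)+
    then show ?thesis using uv snoc by auto
  qed (use uv in auto)
next
  assume "x = y \<and> subseq xs ys \<or> subseq (xs @ [x]) ys"
  then show "subseq (xs @ [x]) (ys @ [y])"
    by (auto simp: subseq_rev_drop_many)
qed

lemma subseq_map_iff: "subseq xs (map f ys) \<longleftrightarrow> (\<exists>zs. subseq zs ys \<and> xs = map f zs)"
proof
  assume "subseq xs (map f ys)"
  then show "\<exists>zs. subseq zs ys \<and> xs = map f zs"
    by (auto simp: subseq_conv_nths nths_map)
qed (auto simp: subseq_map)

text \<open>A subsequence of the new list either omits the last entry, and is then a relabelled
  subsequence of \<open>p\<close>, or ends in \<open>v\<close>.\<close>

lemma ex_subseq_insert_last: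
  "(\<exists>xs. length xs = Suc k \<and> subseq xs (insert_last v p) \<and> Q xs) \<longleftrightarrow>
   (\<exists>xs. length xs = Suc k \<and> subseq xs p \<and> Q (map (shift v) xs)) \<or>
   (\<exists>xs. length xs = k \<and> subseq xs p \<and> Q (map (shift v) xs @ [v]))" (is "?l = ?r")
proof
  assume ?l
  then obtain xs x where "length xs = k" "subseq (xs @ [x]) (insert_last v p)" "Q (xs @ [x])"
    by (metis length_Suc_conv_rev)
  then show ?r unfolding insert_last_def subseq_snoc_snoc subseq_map_iff
    by (metis length_append_singleton length_map)
next
  assume ?r
  then show ?l
  proof
    assume "\<exists>xs. length xs = Suc k \<and> subseq xs p \<and> Q (map (shift v) xs)"
    then obtain xs where "length xs = Suc k" "subseq xs p" "Q (map (shift v) xs)" by blast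
    then show ?l unfolding insert_last_def
      by (metis length_map subseq_map subseq_rev_drop_many)
  next
    assume "\<exists>xs. length xs = k \<and> subseq xs p \<and> Q (map (shift v) xs @ [v])"
    then obtain xs where "length xs = k" "subseq xs p" "Q (map (shift v) xs @ [v])" by blast
    then show ?l unfolding insert_last_def
      by (metis length_append_singleton length_map subseq_map subseq_snoc_snoc)
  qed
qed

section \<open>Pattern containment in terms of subsequences\<close>

lemma ex_length_Suc:
  "(\<exists>xs. length xs = Suc k \<and> P xs) \<longleftrightarrow> (\<exists>x xs. length xs = k \<and> P (x # xs))"
  by (metis length_Suc_conv)

text \<open>Trading the position function for a subsequence of values opens containment to the
  recursion at the last entry.\<close>

lemma contains_pattern_iff:
  "contains_pattern p q \<longleftrightarrow>
     (\<exists>xs. length xs = length q \<and> subseq xs p \<and>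
        (\<forall>i<length q. \<forall>j<length q. xs ! i < xs ! j \<longleftrightarrow> q ! i < q ! j))" (is "?l = ?r")
proof
  assume ?l
  then obtain f where f: "strict_mono_on {..<length q} f" "\<forall>i<length q. f i < length p"
    "\<forall>i<length q. \<forall>j<length q. p ! f i < p ! f j \<longleftrightarrow> q ! i < q ! j"
    unfolding contains_pattern_def by blast
  \<comment> \<open>Induction on the pattern length: cutting \<open>p\<close> just before the last
    position \<open>f k\<close> leaves a prefix that contains all earlier positions.\<close>
  have sub: "subseq (map (\<lambda>i. p ! f i) [0..<k]) p"
    if "strict_mono_on {..<k} f" "\<forall>i<k. f i < length p" for k p
    using that
  proof (induction k arbitrary: p)
    case (Suc k)
    have less: "f i < f k" if "i < k" for i
      using Suc.prems(1) that by (auto simp: strict_mono_on_def)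
    have fk: "f k < length p" using Suc.prems(2) by simp
    have "subseq (map (\<lambda>i. take (f k) p ! f i) [0..<k]) (take (f k) p)"
      using Suc.prems less fk by (intro Suc.IH) (auto simp: strict_mono_on_def)
    moreover have "map (\<lambda>i. take (f k) p ! f i) [0..<k] = map (\<lambda>i. p ! f i) [0..<k]"
      using less by (auto simp: fk)
    ultimately have "subseq (map (\<lambda>i. p ! f i) [0..<Suc k]) (take (Suc (f k)) p)"
      using fk by (simp add: take_Suc_conv_app_nth subseq_snoc_snoc)
    moreover have "subseq (take (Suc (f k)) p) p"
      by (metis append_take_drop_id list_emb_append2 subseq_order.order_refl subseq_rev_drop_many)
    ultimately show ?case by (rule subseq_order.trans)
  qed auto
  show ?r
    using f sub[OF f(1,2)] by (intro exI[of _ "map (\<lambda>i. p ! f i) [0..<length q]"]) auto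
next
  \<comment> \<open>The positions are built along the embedding: a skipped entry raises all of them
    by one, a matched entry also puts position 0 in front.\<close>
  have ex: "\<exists>f. strict_mono_on {..<length xs} f \<and> (\<forall>i<length xs. f i < length p \<and> p ! f i = xs ! i)"
    if "subseq xs p" for xs
    using that
  proof (induction rule: list_emb.induct)
    case (list_emb_Nil ys)
    then show ?case by (auto simp: strict_mono_on_def)
  next
    case (list_emb_Cons xs ys y)
    then obtain f where f: "strict_mono_on {..<length xs} f"
      "\<forall>i<length xs. f i < length ys \<and> ys ! f i = xs ! i" by blast
    then show ?case
      by (intro exI[of _ "\<lambda>i. Suc (f i)"]) (auto simp: strict_mono_on_def)
  next
    case (list_emb_Cons2 x y xs ys)
    then obtain f where f: "strict_mono_on {..<length xs} f"
      "\<forall>i<length xs. f i < length ys \<and> ys ! f i = xs ! i" by blast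
    then show ?case using list_emb_Cons2(1)
      by (intro exI[of _ "\<lambda>i. case i of 0 \<Rightarrow> 0 | Suc i \<Rightarrow> Suc (f i)"])
        (auto simp: strict_mono_on_def split: nat.splits)
  qed
  assume ?r
  then obtain xs where xs: "length xs = length q" "subseq xs p"
     "\<forall>i<length q. \<forall>j<length q. xs ! i < xs ! j \<longleftrightarrow> q ! i < q ! j" by blast
  from ex[OF xs(2)] obtain f where "strict_mono_on {..<length q} f"
    "\<forall>i<length q. f i < length p \<and> p ! f i = xs ! i" using xs(1) by auto
  then show ?l unfolding contains_pattern_def using xs(3) by (intro exI[of _ f]) auto
qed

lemma contains_3412: "contains_pattern p [3,4,1,2] \<longleftrightarrow>
  (\<exists>a b c d. subseq [a,b,c,d] p \<and> c < d \<and> d < a \<and> a < b)"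
  unfolding contains_pattern_iff
  by (simp add: ex_length_Suc numeral_eq_Suc All_less_Suc) (intro iff_exI; auto)

lemma contains_4321: "contains_pattern p [4,3,2,1] \<longleftrightarrow>
  (\<exists>a b c d. subseq [a,b,c,d] p \<and> d < c \<and> c < b \<and> b < a)"
  unfolding contains_pattern_iff
  by (simp add: ex_length_Suc numeral_eq_Suc All_less_Suc) (intro iff_exI; auto)

lemma contains_4231: "contains_pattern p [4,2,3,1] \<longleftrightarrow>
  (\<exists>a b c d. subseq [a,b,c,d] p \<and> d < b \<and> b < c \<and> c < a)"
  unfolding contains_pattern_iff
  by (simp add: ex_length_Suc numeral_eq_Suc All_less_Suc) (intro iff_exI; auto)

lemma contains_45321: "contains_pattern p [4,5,3,2,1] \<longleftrightarrow>
  (\<exists>a b c d e. subseq [a,b,c,d,e] p \<and> e < d \<and> d < c \<and> c < a \<and> a < b)"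
  unfolding contains_pattern_iff
  by (simp add: ex_length_Suc numeral_eq_Suc All_less_Suc) (intro iff_exI; auto)

lemma contains_54312: "contains_pattern p [5,4,3,1,2] \<longleftrightarrow>
  (\<exists>a b c d e. subseq [a,b,c,d,e] p \<and> d < e \<and> e < c \<and> c < b \<and> b < a)"
  unfolding contains_pattern_iff
  by (simp add: ex_length_Suc numeral_eq_Suc All_less_Suc) (intro iff_exI; auto)

section \<open>Subsequences of fixed length after an insertion\<close>

lemma ex_subseq2_insert_last:
  "(\<exists>a b. subseq [a, b] (insert_last v p) \<and> Q a b) \<longleftrightarrow>
   (\<exists>a b. subseq [a, b] p \<and> Q (shift v a) (shift v b)) \<or>
   (\<exists>a\<in>set p. Q (shift v a) v)"
  using ex_subseq_insert_last[of 1 v p "\<lambda>xs. Q (xs ! 0) (xs ! 1)"]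
  by (simp add: ex_length_Suc subseq_singleton_left Bex_def)

lemma ex_subseq3_insert_last:
  "(\<exists>a b c. subseq [a, b, c] (insert_last v p) \<and> Q a b c) \<longleftrightarrow>
   (\<exists>a b c. subseq [a, b, c] p \<and> Q (shift v a) (shift v b) (shift v c)) \<or>
   (\<exists>a b. subseq [a, b] p \<and> Q (shift v a) (shift v b) v)"
  using ex_subseq_insert_last[of 2 v p "\<lambda>xs. Q (xs ! 0) (xs ! 1) (xs ! 2)"]
  by (simp add: ex_length_Suc numeral_eq_Suc)

lemma ex_subseq4_insert_last:
  "(\<exists>a b c d. subseq [a, b, c, d] (insert_last v p) \<and> Q a b c d) \<longleftrightarrow>
   (\<exists>a b c d. subseq [a, b, c, d] p \<and> Q (shift v a) (shift v b) (shift v c) (shift v d)) \<or>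
   (\<exists>a b c. subseq [a, b, c] p \<and> Q (shift v a) (shift v b) (shift v c) v)"
  using ex_subseq_insert_last[of 3 v p "\<lambda>xs. Q (xs ! 0) (xs ! 1) (xs ! 2) (xs ! 3)"]
  by (simp add: ex_length_Suc numeral_eq_Suc)

lemma ex_subseq5_insert_last:
  "(\<exists>a b c d e. subseq [a, b, c, d, e] (insert_last v p) \<and> Q a b c d e) \<longleftrightarrow>
   (\<exists>a b c d e. subseq [a, b, c, d, e] p \<and>
      Q (shift v a) (shift v b) (shift v c) (shift v d) (shift v e)) \<or>
   (\<exists>a b c d. subseq [a, b, c, d] p \<and>
      Q (shift v a) (shift v b) (shift v c) (shift v d) v)"
  using ex_subseq_insert_last[of 4 v p "\<lambda>xs. Q (xs ! 0) (xs ! 1) (xs ! 2) (xs ! 3) (xs ! 4)"]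
  by (simp add: ex_length_Suc numeral_eq_Suc)

lemma subseq_set: "subseq xs p \<Longrightarrow> set xs \<subseteq> set p"
  by (induction rule: list_emb.induct) auto

subsection \<open>Gaps of a permutation\<close>

text \<open>A gap \<open>g\<close> stands for the place just below the value \<open>g\<close>: the entries above it are those \<open>\<ge> g\<close>,
and \<open>inv_across p g h\<close> says that some entry between the gaps \<open>g\<close> and \<open>h\<close> is preceded by one
above \<open>h\<close>.  A gap is \<open>blocked\<close> for a pattern if appending an entry there completes the pattern.\<close>

definition asc_above :: "nat list \<Rightarrow> nat \<Rightarrow> bool" where
  "asc_above p g \<longleftrightarrow> (\<exists>a b. subseq [a, b] p \<and> g \<le> a \<and> a < b)"

definition desc_above :: "nat list \<Rightarrow> nat \<Rightarrow> bool" where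
  "desc_above p g \<longleftrightarrow> (\<exists>a b. subseq [a, b] p \<and> g \<le> b \<and> b < a)"

definition inv_across :: "nat list \<Rightarrow> nat \<Rightarrow> nat \<Rightarrow> bool" where
  "inv_across p g h \<longleftrightarrow> (\<exists>a b. subseq [a, b] p \<and> g \<le> b \<and> b < h \<and> h \<le> a)"

definition above_231 :: "nat list \<Rightarrow> nat \<Rightarrow> bool" where
  "above_231 p g \<longleftrightarrow> (\<exists>a b c. subseq [a, b, c] p \<and> g \<le> c \<and> c < a \<and> a < b)"

definition above_321 :: "nat list \<Rightarrow> nat \<Rightarrow> bool" where
  "above_321 p g \<longleftrightarrow> (\<exists>a b c. subseq [a, b, c] p \<and> g \<le> c \<and> c < b \<and> b < a)"

definition blocked_3412 :: "nat list \<Rightarrow> nat \<Rightarrow> bool" where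
  "blocked_3412 p g \<longleftrightarrow> (\<exists>a b c. subseq [a, b, c] p \<and> c < g \<and> g \<le> a \<and> a < b)"

definition blocked_4231 :: "nat list \<Rightarrow> nat \<Rightarrow> bool" where
  "blocked_4231 p g \<longleftrightarrow> (\<exists>a b c. subseq [a, b, c] p \<and> g \<le> b \<and> b < c \<and> c < a)"

definition blocked_45321 :: "nat list \<Rightarrow> nat \<Rightarrow> bool" where
  "blocked_45321 p g \<longleftrightarrow> (\<exists>a b c d. subseq [a, b, c, d] p \<and> g \<le> d \<and> d < c \<and> c < a \<and> a < b)"

definition blocked_54312 :: "nat list \<Rightarrow> nat \<Rightarrow> bool" where
  "blocked_54312 p g \<longleftrightarrow> (\<exists>a b c d. subseq [a, b, c, d] p \<and> d < g \<and> g \<le> c \<and> c < b \<and> b < a)"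

lemmas above_defs = asc_above_def desc_above_def inv_across_def above_231_def above_321_def

section \<open>How the data of a gap change under an insertion\<close>

lemma set_insert_last:
  assumes "set p = {1..n}" "v \<in> {1..Suc n}"
  shows "set (insert_last v p) = {1..Suc n}"
proof (intro equalityI subsetI)
  fix x assume x: "x \<in> {1..Suc n}"
  consider "x = v" | "x < v" | "v < x" by linarith
  then show "x \<in> set (insert_last v p)"
  proof cases
    case 2
    then have "x \<in> set p" "x = shift v x" using assms x by (auto simp: shift_def)
    then show ?thesis unfolding insert_last_def by (metis UnI1 image_eqI set_append set_map)
  next
    case 3
    then have "x - 1 \<in> set p" "x = shift v (x - 1)" using assms x by (auto simp: shift_def)
    then show ?thesis unfolding insert_last_def by (metis UnI1 image_eqI set_append set_map)
  qed (auto simp: insert_last_def)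
qed (use assms in \<open>auto simp: insert_last_def shift_def split: if_splits\<close>)

text \<open>A gap at most \<open>v\<close> keeps its name and a gap at least \<open>v\<close> is
  raised by one, so \<open>v\<close> itself splits into the gaps \<open>v\<close> and
  \<open>Suc v\<close>. For g < v the entry \<open>g\<close> and the appended \<open>v\<close> form
  an ascent; in the second case the new entry lies below the gap.\<close>

lemma asc_above_insert_last:
  assumes "set p = {1..n}" "v \<in> {1..Suc n}" "1 \<le> g"
  shows "g \<le> v \<Longrightarrow> asc_above (insert_last v p) g \<longleftrightarrow> asc_above p g \<or> g < v"
    and "v \<le> g \<Longrightarrow> asc_above (insert_last v p) (Suc g) \<longleftrightarrow> asc_above p g"
  unfolding asc_above_def ex_subseq2_insert_last using assms
  by (auto intro!: bexI[of _ g])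

text \<open>For v \<le> n the entry \<open>v\<close> is raised to \<open>Suc v\<close> and precedes
  the new one.\<close>

lemma desc_above_insert_last:
  assumes "set p = {1..n}" "v \<in> {1..Suc n}"
  shows "g \<le> v \<Longrightarrow> desc_above (insert_last v p) g \<longleftrightarrow> desc_above p g \<or> v \<le> n"
    and "v \<le> g \<Longrightarrow> desc_above (insert_last v p) (Suc g) \<longleftrightarrow> desc_above p g"
  unfolding desc_above_def ex_subseq2_insert_last using assms
  by (auto intro!: bexI[of _ v])

text \<open>In the mixed case the inversion consists of the entry \<open>h\<close>, raised to
  \<open>Suc h\<close>, and the appended \<open>v\<close>.\<close>

lemma inv_across_insert_last:
  assumes "set p = {1..n}" "v \<in> {1..Suc n}"
  shows "g \<le> v \<Longrightarrow> h \<le> v \<Longrightarrow> inv_across (insert_last v p) g h \<longleftrightarrow> inv_across p g h"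
    and "g \<le> v \<Longrightarrow> v \<le> h \<Longrightarrow> h \<le> n \<Longrightarrow> inv_across (insert_last v p) g (Suc h)"
    and "v \<le> g \<Longrightarrow> v \<le> h \<Longrightarrow> inv_across (insert_last v p) (Suc g) (Suc h) \<longleftrightarrow> inv_across p g h"
  unfolding inv_across_def ex_subseq2_insert_last using assms
  by (auto intro!: bexI[of _ h])

lemma above_231_insert_last:
  "g \<le> v \<Longrightarrow> above_231 (insert_last v p) g \<longleftrightarrow> above_231 p g \<or> asc_above p v"
  "v \<le> g \<Longrightarrow> above_231 (insert_last v p) (Suc g) \<longleftrightarrow> above_231 p g"
  unfolding above_defs ex_subseq3_insert_last by auto

lemma above_321_insert_last:
  "g \<le> v \<Longrightarrow> above_321 (insert_last v p) g \<longleftrightarrow> above_321 p g \<or> desc_above p v"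
  "v \<le> g \<Longrightarrow> above_321 (insert_last v p) (Suc g) \<longleftrightarrow> above_321 p g"
  unfolding above_defs ex_subseq3_insert_last by auto

text \<open>In 341 the new entry can only be the 1, so it lies below the gap and follows an ascent
  above the gap.\<close>

lemma blocked_3412_insert_last:
  "g \<le> v \<Longrightarrow> blocked_3412 (insert_last v p) g \<longleftrightarrow> blocked_3412 p g"
  "v \<le> g \<Longrightarrow> blocked_3412 (insert_last v p) (Suc g) \<longleftrightarrow> blocked_3412 p g \<or> asc_above p g"
  unfolding blocked_3412_def above_defs ex_subseq3_insert_last by auto

text \<open>In 423 the new entry can only be the 3, so the 4 and the 2 form an inversion across
  \<open>g\<close> and \<open>v\<close>.\<close>

lemma blocked_4231_insert_last:
  "g \<le> v \<Longrightarrow> blocked_4231 (insert_last v p) g \<longleftrightarrow> blocked_4231 p g \<or> inv_across p g v"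
  "v \<le> g \<Longrightarrow> blocked_4231 (insert_last v p) (Suc g) \<longleftrightarrow> blocked_4231 p g"
  unfolding blocked_4231_def above_defs ex_subseq3_insert_last by auto

text \<open>The new entry is the 2 of 4532, and the 453 before it is a 231 above
  \<open>v\<close>.\<close>

lemma blocked_45321_insert_last:
  "g \<le> v \<Longrightarrow> blocked_45321 (insert_last v p) g \<longleftrightarrow> blocked_45321 p g \<or> above_231 p v"
  "v \<le> g \<Longrightarrow> blocked_45321 (insert_last v p) (Suc g) \<longleftrightarrow> blocked_45321 p g"
  unfolding blocked_45321_def above_defs ex_subseq4_insert_last by auto

text \<open>The new entry is the 1 of 5431, below the gap, and the 543 before it is a 321 above the
  gap.\<close>

lemma blocked_54312_insert_last:
  "g \<le> v \<Longrightarrow> blocked_54312 (insert_last v p) g \<longleftrightarrow> blocked_54312 p g"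
  "v \<le> g \<Longrightarrow> blocked_54312 (insert_last v p) (Suc g) \<longleftrightarrow> blocked_54312 p g \<or> above_321 p g"
  unfolding blocked_54312_def above_defs ex_subseq4_insert_last by auto

lemma contains_3412_insert_last:
  "contains_pattern (insert_last v p) [3,4,1,2] \<longleftrightarrow> contains_pattern p [3,4,1,2] \<or> blocked_3412 p v"
  unfolding contains_3412 ex_subseq4_insert_last blocked_3412_def by auto

lemma contains_4321_insert_last:
  "contains_pattern (insert_last v p) [4,3,2,1] \<longleftrightarrow> contains_pattern p [4,3,2,1] \<or> above_321 p v"
  unfolding contains_4321 ex_subseq4_insert_last above_321_def by auto

lemma contains_4231_insert_last:
  "contains_pattern (insert_last v p) [4,2,3,1] \<longleftrightarrow> contains_pattern p [4,2,3,1] \<or> blocked_4231 p v"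
  unfolding contains_4231 ex_subseq4_insert_last blocked_4231_def by auto

lemma contains_45321_insert_last:
  "contains_pattern (insert_last v p) [4,5,3,2,1] \<longleftrightarrow> contains_pattern p [4,5,3,2,1] \<or> blocked_45321 p v"
  unfolding contains_45321 ex_subseq5_insert_last blocked_45321_def by auto

lemma contains_54312_insert_last:
  "contains_pattern (insert_last v p) [5,4,3,1,2] \<longleftrightarrow> contains_pattern p [5,4,3,1,2] \<or> blocked_54312 p v"
  unfolding contains_54312 ex_subseq5_insert_last blocked_54312_def by auto

section \<open>Implications between the conditions, and the two top gaps\<close>

lemma asc_above_antimono: "asc_above p g \<Longrightarrow> h \<le> g \<Longrightarrow> asc_above p h"
  unfolding above_defs by (meson le_trans)

lemma desc_above_antimono: "desc_above p g \<Longrightarrow> h \<le> g \<Longrightarrow> desc_above p h"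
  unfolding above_defs by (meson le_trans)

lemma subseq_pair_of_triple:
  assumes "subseq [a, b, c] p"
  shows "subseq [a, b] p" "subseq [a, c] p" "subseq [b, c] p"
proof -
  have "subseq [a, b] [a, b, c]" "subseq [a, c] [a, b, c]" "subseq [b, c] [a, b, c]" by auto
  then show "subseq [a, b] p" "subseq [a, c] p" "subseq [b, c] p"
    using assms subseq_order.trans by blast+
qed

lemma above_231_imp_asc_above: "above_231 p g \<Longrightarrow> asc_above p g"
  unfolding above_defs by (meson less_imp_le_nat le_trans subseq_pair_of_triple)

lemma above_321_imp_desc_above: "above_321 p g \<Longrightarrow> desc_above p g"
  unfolding above_defs by (meson subseq_pair_of_triple)

lemma inv_across_imp_desc_above: "inv_across p g h \<Longrightarrow> desc_above p g"
  unfolding above_defs by (meson less_le_trans)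

text \<open>Each configuration needs two distinct entries that are at least \<open>g\<close>, while
  at most \<open>n\<close> itself is available. Hence the gaps \<open>n\<close> and
  \<open>n + 1\<close> are never blocked.\<close>

lemma top_gaps:
  assumes "set p = {1..n}" "n \<le> g"
  shows "\<not> asc_above p g" "\<not> desc_above p g" "\<not> blocked_3412 p g" "\<not> blocked_4231 p g"
    "\<not> blocked_45321 p g" "\<not> blocked_54312 p g"
  using assms
  unfolding above_defs blocked_3412_def blocked_4231_def blocked_45321_def blocked_54312_def
  by (auto dest!: subseq_set)

lemma not_inv_across_top: "set p = {1..n} \<Longrightarrow> n < h \<Longrightarrow> \<not> inv_across p g h"
  unfolding above_defs by (auto dest!: subseq_set)

lemma not_inv_across_le: "h \<le> g \<Longrightarrow> \<not> inv_across p g h"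
  unfolding above_defs by auto

subsection \<open>The generating tree\<close>

lemma insert_last_eq_iff: "insert_last v p = insert_last w q \<longleftrightarrow> v = w \<and> p = q"
proof -
  have "inj (shift v)" by (auto intro: injI)
  then show ?thesis by (auto simp: insert_last_def inj_map_eq_map)
qed

text \<open>The image lies in the target, insertion is injective, and both sides have (n + 1)!
  elements.\<close>

lemma insert_last_permutations_of_set:
  "(\<lambda>(v, p). insert_last v p) ` ({1..Suc n} \<times> permutations_of_set {1..n})
     = permutations_of_set {1..Suc n}"
proof (rule card_subset_eq)
  show "(\<lambda>(v, p). insert_last v p) ` ({1..Suc n} \<times> permutations_of_set {1..n})
    \<subseteq> permutations_of_set {1..Suc n}"
  proof clarify
    fix v p assume v: "v \<in> {1..Suc n}" and p: "p \<in> permutations_of_set {1..n}"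
    have "distinct (insert_last v p)"
      using p by (auto simp: insert_last_def distinct_map permutations_of_set_def intro: inj_onI)
    then show "insert_last v p \<in> permutations_of_set {1..Suc n}"
      using set_insert_last[OF _ v] p by (auto simp: permutations_of_set_def)
  qed
  have "inj_on (\<lambda>(v, p). insert_last v p) ({1..Suc n} \<times> permutations_of_set {1..n})"
    by (auto simp: inj_on_def insert_last_eq_iff)
  then show "card ((\<lambda>(v, p). insert_last v p) ` ({1..Suc n} \<times> permutations_of_set {1..n}))
    = card (permutations_of_set {1..Suc n})"
    by (simp add: card_image card_cartesian_product)
qed simp

fun descendants :: "(nat list \<Rightarrow> nat \<Rightarrow> bool) \<Rightarrow> nat \<Rightarrow> nat list \<Rightarrow> nat" where
  "descendants bl 0 p = 1"
| "descendants bl (Suc t) p =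
     (\<Sum>v | v \<in> {1..Suc (length p)} \<and> \<not> bl p v. descendants bl t (insert_last v p))"

text \<open>By the hypothesis, deleting the last entry stays in the class, and \<open>bl\<close>
  alone decides which values can be appended.\<close>

lemma card_Av_eq_sum_descendants:
  assumes bl: "\<And>p v. (\<forall>q\<in>S. \<not> contains_pattern (insert_last v p) q)
      \<longleftrightarrow> (\<forall>q\<in>S. \<not> contains_pattern p q) \<and> \<not> bl p v"
  shows "card (Av (n + t) S) = (\<Sum>p\<in>Av n S. descendants bl t p)"
proof (induction t arbitrary: n)
  case (Suc t)
  have fin: "finite (Av n S)" by (simp add: Av_def)
  define P where "P p \<longleftrightarrow> (\<forall>q\<in>S. \<not> contains_pattern p q)" for p
  have P: "P (insert_last v p) \<longleftrightarrow> P p \<and> \<not> bl p v" for v p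
    unfolding P_def by (rule bl)
  have Av: "Av m S = {p \<in> permutations_of_set {1..m}. P p}" for m
    by (simp add: Av_def P_def)
  \<comment> \<open>Pairs of a parent and an admissible value; \<open>insert_last\<close> maps them
    bijectively onto the next level.\<close>
  define I where "I = (SIGMA p:Av n S. {v. v \<in> {1..Suc (length p)} \<and> \<not> bl p v})"
  have "Av (Suc n) S = {p \<in> (\<lambda>(v, p). insert_last v p) ` ({1..Suc n} \<times> permutations_of_set {1..n}).
      P p}"
    unfolding Av insert_last_permutations_of_set ..
  also have "\<dots> = (\<lambda>(p, v). insert_last v p) ` I"
    unfolding I_def Av by (auto simp: P length_finite_permutations_of_set)
  finally have img: "Av (Suc n) S = (\<lambda>(p, v). insert_last v p) ` I" .
  have inj: "inj_on (\<lambda>(p, v). insert_last v p) I"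
    by (auto simp: inj_on_def insert_last_eq_iff)
  have "card (Av (n + Suc t) S) = (\<Sum>p\<in>Av (Suc n) S. descendants bl t p)"
    using Suc.IH[of "Suc n"] by simp
  also have "\<dots> = (\<Sum>(p, v)\<in>I. descendants bl t (insert_last v p))"
    unfolding img by (subst sum.reindex[OF inj]) (simp add: case_prod_unfold)
  also have "\<dots> = (\<Sum>p\<in>Av n S. descendants bl (Suc t) p)"
    unfolding I_def by (subst sum.Sigma[symmetric]) (auto simp: fin)
  finally show ?case .
qed simp

text \<open>The empty permutation has [1] as its only child, so the tree can be rooted there, where
  the states below already make sense.\<close>

lemma card_Av_Suc:
  assumes bl: "\<And>p v. (\<forall>q\<in>S. \<not> contains_pattern (insert_last v p) q)
      \<longleftrightarrow> (\<forall>q\<in>S. \<not> contains_pattern p q) \<and> \<not> bl p v"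
    and "[] \<notin> S" "\<not> bl [] 1"
  shows "card (Av (Suc t) S) = descendants bl t [1]"
proof -
  have "Av 0 S = {[]}"
    using \<open>[] \<notin> S\<close> by (auto simp: Av_def contains_pattern_def)
  moreover have "{v. v = Suc 0 \<and> \<not> bl [] v} = {1}" using \<open>\<not> bl [] 1\<close> by auto
  ultimately show ?thesis
    using card_Av_eq_sum_descendants[OF bl, where n = 0 and t = "Suc t"]
    by (simp add: insert_last_def)
qed

text \<open>The two top gaps are left out: they are admissible in both classes, and only the gaps
  below them distinguish the states.\<close>

definition low :: "(nat list \<Rightarrow> nat \<Rightarrow> bool) \<Rightarrow> nat list \<Rightarrow> nat set" where
  "low bl p = {g \<in> {1..<length p}. \<not> bl p g}"

lemma finite_low [simp]: "finite (low bl p)"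
  by (simp add: low_def)

lemma descendants_Suc:
  assumes "length p = n" "1 \<le> n" "\<not> bl p n" "\<not> bl p (Suc n)"
  shows "descendants bl (Suc t) p = descendants bl t (insert_last (Suc n) p)
    + descendants bl t (insert_last n p) + (\<Sum>g\<in>low bl p. descendants bl t (insert_last g p))"
proof -
  have "{v. v \<in> {1..Suc n} \<and> \<not> bl p v} = insert (Suc n) (insert n (low bl p))"
    using assms by (auto simp: low_def)
  moreover have "n \<notin> low bl p" "Suc n \<notin> low bl p" using assms by (auto simp: low_def)
  ultimately show ?thesis using assms by simp
qed

text \<open>\<open>geom4 t = 1 + 4 + \<dots> + 4 ^ (t - 1)\<close>; all coefficients of the descendant counts reduce to it.\<close>

primrec geom4 :: "nat \<Rightarrow> nat" where
  "geom4 0 = 0"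
| "geom4 (Suc t) = 4 * geom4 t + 1"

text \<open>In the ascent state of either class, the coefficient of the number of lower gaps;
  \<open>coeff_weight\<close> is that of their total weight.\<close>

primrec coeff_asc :: "nat \<Rightarrow> nat" where
  "coeff_asc 0 = 0"
| "coeff_asc (Suc t) = 3 * geom4 t + 1"

primrec coeff_weight :: "nat \<Rightarrow> nat" where
  "coeff_weight 0 = 0"
| "coeff_weight (Suc t) = geom4 t"

text \<open>Appending \<open>n + 1\<close> adds the lower gap \<open>n\<close>, which counts in both
  parameters; hence the sum of the two coefficients.\<close>

lemma geom4_eq: "geom4 t = coeff_asc t + coeff_weight t"
  by (cases t) auto

subsection \<open>Avoiding 3412 and 4321\<close>

definition blocked_A :: "nat list \<Rightarrow> nat \<Rightarrow> bool" where
  "blocked_A p g \<longleftrightarrow> blocked_3412 p g \<or> above_321 p g"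

lemma blocked_A_insert_last:
  "g \<le> v \<Longrightarrow> blocked_A (insert_last v p) g \<longleftrightarrow> blocked_A p g \<or> desc_above p v"
  "v \<le> g \<Longrightarrow> blocked_A (insert_last v p) (Suc g) \<longleftrightarrow> blocked_A p g \<or> asc_above p g"
  unfolding blocked_A_def by (auto simp: blocked_3412_insert_last above_321_insert_last)

text \<open>The gap \<open>g\<close> itself is included, as the lower half of the split gap. A
  descent above \<open>g\<close> would become a 321 above each of these gaps, so none would
  survive.\<close>

definition weight_A :: "nat list \<Rightarrow> nat \<Rightarrow> nat" where
  "weight_A p g = (if desc_above p g then 0 else card {h \<in> low blocked_A p. h \<le> g})"

definition is_perm :: "nat \<Rightarrow> nat list \<Rightarrow> bool" where
  "is_perm n p \<longleftrightarrow> set p = {1..n} \<and> length p = n \<and> 1 \<le> n"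

lemma is_perm_insert_last: "is_perm n p \<Longrightarrow> v \<in> {1..Suc n} \<Longrightarrow> is_perm (Suc n) (insert_last v p)"
  using set_insert_last by (auto simp: is_perm_def)

text \<open>The state of [1] and of every longer permutation that ends in its maximum. Once an entry
  is inserted at or below a gap with an ascent above it, the part of the gap above that entry is
  blocked by 3412.\<close>

definition state_asc_A :: "nat list \<Rightarrow> nat \<Rightarrow> nat \<Rightarrow> bool" where
  "state_asc_A p k W \<longleftrightarrow> (\<forall>g\<in>low blocked_A p. asc_above p g) \<and>
     card (low blocked_A p) = k \<and> (\<Sum>g\<in>low blocked_A p. weight_A p g) = W"

text \<open>The descent above the highest lower gap lies above all the others too, so every weight
  vanishes and \<open>k\<close> is the only parameter.\<close>

definition state_desc_A :: "nat list \<Rightarrow> nat \<Rightarrow> bool" where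
  "state_desc_A p k \<longleftrightarrow> (\<exists>g R. low blocked_A p = insert g R \<and> (\<forall>h\<in>R. h < g \<and> asc_above p h) \<and>
     desc_above p g \<and> \<not> asc_above p g \<and> card R = k)"

section \<open>Transitions between the states of the first class\<close>

context
  fixes p :: "nat list" and n :: nat
  assumes p: "is_perm n p"
begin

lemma set_p: "set p = {1..n}" and len_p: "length p = n" and n_pos: "1 \<le> n"
  using p by (auto simp: is_perm_def)

lemma low_less: "g \<in> low bl p \<Longrightarrow> 1 \<le> g \<and> g < n"
  by (auto simp: low_def len_p)

lemma not_blocked_A_top: "n \<le> g \<Longrightarrow> \<not> blocked_A p g"
  using top_gaps[OF set_p] by (auto simp: blocked_A_def dest: above_321_imp_desc_above)

lemmas not_asc_above_top = top_gaps(1)[OF set_p] and not_desc_above_top = top_gaps(2)[OF set_p]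

lemmas asc_ins = asc_above_insert_last[OF set_p] and desc_ins = desc_above_insert_last[OF set_p]

lemma low_A_top:
  "low blocked_A (insert_last (Suc n) p) = insert n (low blocked_A p)"
  using n_pos
  by (auto simp: low_def len_p blocked_A_insert_last not_blocked_A_top not_desc_above_top)

lemma low_A_second:
  "low blocked_A (insert_last n p) = insert n (low blocked_A p)"
  using n_pos
  by (auto simp: low_def len_p blocked_A_insert_last not_blocked_A_top not_desc_above_top)

text \<open>The gaps up to \<open>g\<close> keep their names, those from \<open>g\<close> on are
  raised; being split, \<open>g\<close> may contribute to both parts.\<close>

lemma low_A_low:
  assumes "g \<in> low blocked_A p"
  shows "low blocked_A (insert_last g p) =
    {h \<in> low blocked_A p. h \<le> g \<and> \<not> desc_above p g} \<union>
    Suc ` {h \<in> low blocked_A p. g \<le> h \<and> \<not> asc_above p h}" (is "?l = ?r")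
proof (rule set_eqI)
  fix x
  show "x \<in> ?l \<longleftrightarrow> x \<in> ?r"
  proof (cases "x \<le> g")
    case True
    then show ?thesis using low_less[OF assms]
      by (auto simp: low_def len_p blocked_A_insert_last)
  next
    case False
    then obtain y where "x = Suc y" "g \<le> y" by (cases x) auto
    then show ?thesis using low_less[OF assms]
      by (auto simp: low_def len_p blocked_A_insert_last)
  qed
qed

text \<open>A new maximum creates no descent and so changes no old weight; the new gap
  \<open>n\<close> counts itself and all old lower gaps.\<close>

lemma state_asc_A_top:
  "state_asc_A (insert_last (Suc n) p) (Suc (card (low blocked_A p)))
     ((\<Sum>g\<in>low blocked_A p. weight_A p g) + Suc (card (low blocked_A p)))"
proof -
  let ?L = "low blocked_A p" and ?q = "insert_last (Suc n) p"
  have n: "n \<notin> ?L" using low_less by blast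
  have "weight_A ?q g = weight_A p g" if "g \<in> ?L" for g
  proof -
    have "{h. (h = n \<or> h \<in> ?L) \<and> h \<le> g} = {h \<in> ?L. h \<le> g}"
      using low_less[OF that] by auto
    then show ?thesis using low_less[OF that] by (simp add: weight_A_def desc_ins low_A_top)
  qed
  moreover have "weight_A ?q n = Suc (card ?L)"
  proof -
    have "{h. (h = n \<or> h \<in> ?L) \<and> h \<le> n} = insert n ?L"
      using low_less by force
    then show ?thesis using n
      by (simp add: weight_A_def desc_ins low_A_top not_desc_above_top)
  qed
  ultimately have "(\<Sum>g\<in>low blocked_A ?q. weight_A ?q g)
      = (\<Sum>g\<in>?L. weight_A p g) + Suc (card ?L)"
    using n by (simp add: low_A_top)
  moreover have "asc_above ?q g" if "g \<in> low blocked_A ?q" for g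
  proof -
    have "1 \<le> g" "g \<le> n" using that low_less[of g blocked_A] n_pos by (auto simp: low_A_top)
    then show ?thesis by (simp add: asc_ins)
  qed
  ultimately show ?thesis using n by (simp add: state_asc_A_def low_A_top)
qed

text \<open>The appended \<open>n\<close> forms a descent with the raised maximum and an ascent with
  each smaller entry.\<close>

lemma state_desc_A_second: "state_desc_A (insert_last n p) (card (low blocked_A p))"
proof -
  have "h < n \<and> asc_above (insert_last n p) h" if "h \<in> low blocked_A p" for h
    using low_less[OF that] by (simp add: asc_ins)
  moreover have "desc_above (insert_last n p) n" "\<not> asc_above (insert_last n p) n"
    using n_pos by (simp_all add: asc_ins desc_ins not_asc_above_top)
  ultimately show ?thesis
    unfolding state_desc_A_def low_A_second by blast
qed

text \<open>Gaps above \<open>g\<close> are lost to their ascents. The new entry follows a larger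
  one, so all survivors have a descent above them and weight 0.\<close>

lemma state_asc_A_low:
  assumes "state_asc_A p k W" "g \<in> low blocked_A p"
  shows "state_asc_A (insert_last g p) (weight_A p g) 0"
proof -
  have L: "low blocked_A (insert_last g p) = {h \<in> low blocked_A p. h \<le> g \<and> \<not> desc_above p g}"
    using assms by (auto simp: low_A_low state_asc_A_def)
  have g: "1 \<le> g" "g < n" using low_less assms(2) by auto
  have "asc_above (insert_last g p) h \<and> weight_A (insert_last g p) h = 0"
    if "h \<in> low blocked_A (insert_last g p)" for h
  proof -
    have "h \<le> g" "1 \<le> h" "asc_above p h"
      using that assms(1) low_less[of h blocked_A] by (auto simp: L state_asc_A_def)
    then show ?thesis using g by (simp add: asc_ins desc_ins weight_A_def)
  qed
  moreover from this have "(\<Sum>h\<in>low blocked_A (insert_last g p). weight_A (insert_last g p) h) = 0"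
    by (intro sum.neutral) blast
  moreover have "card (low blocked_A (insert_last g p)) = weight_A p g"
    unfolding L by (cases "desc_above p g") (simp_all add: weight_A_def)
  ultimately show ?thesis
    unfolding state_asc_A_def by blast
qed

text \<open>The descent destroys everything up to \<open>g\<close>, the ascents everything above it
  except the highest gap \<open>g1\<close>, which survives as \<open>Suc g1\<close>.\<close>

lemma state_desc_A_low:
  assumes "state_desc_A p k" "g \<in> low blocked_A p"
  shows "state_desc_A (insert_last g p) 0"
proof -
  obtain g1 R where L: "low blocked_A p = insert g1 R" "\<forall>h\<in>R. h < g1 \<and> asc_above p h"
    "desc_above p g1" "\<not> asc_above p g1"
    using assms(1) unfolding state_desc_A_def by blast
  have "g \<le> g1" using assms(2) L by auto
  then have g: "1 \<le> g" "g < n" "g \<le> g1" "desc_above p g"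
    using low_less assms(2) desc_above_antimono[OF L(3)] by auto
  have "{h \<in> insert g1 R. h \<le> g \<and> \<not> desc_above p g} = {}"
    "{h \<in> insert g1 R. g \<le> h \<and> \<not> asc_above p h} = {g1}"
    using L g by auto
  then have "low blocked_A (insert_last g p) = {Suc g1}"
    unfolding low_A_low[OF assms(2)] L(1) by (metis Un_empty_left image_empty image_insert)
  moreover have "desc_above (insert_last g p) (Suc g1)" "\<not> asc_above (insert_last g p) (Suc g1)"
    using g L(3,4) by (simp_all add: asc_ins desc_ins)
  ultimately show ?thesis unfolding state_desc_A_def
    by (intro exI[of _ "Suc g1"] exI[of _ "{}"]) simp
qed

end

section \<open>Counting descendants in the first class\<close>

lemma sum_affine: "(\<Sum>x\<in>A. a + b * f x) = a * card A + b * (\<Sum>x\<in>A. f x)"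
  for a b :: nat
  by (simp add: sum.distrib sum_distrib_left)

lemma descendants_A:
  assumes "is_perm n p"
  shows "(state_asc_A p k W \<longrightarrow>
      descendants blocked_A t p = geom4 t + 1 + coeff_asc t * k + coeff_weight t * W) \<and>
    (state_desc_A p k \<longrightarrow>
      descendants blocked_A t p = 2 * geom4 t + 1 + geom4 t * k)"
  using assms
proof (induction t arbitrary: n p k W)
  case (Suc t)
  let ?L = "low blocked_A p" and ?d = "descendants blocked_A"
  note p = \<open>is_perm n p\<close>
  have asc: "?d t q = geom4 t + 1 + coeff_asc t * j + coeff_weight t * V"
    if "is_perm (Suc n) q" "state_asc_A q j V" for q j V
    using Suc.IH that by blast
  have desc: "?d t q = 2 * geom4 t + 1 + geom4 t * j"
    if "is_perm (Suc n) q" "state_desc_A q j" for q j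
    using Suc.IH that by blast
  have perm: "is_perm (Suc n) (insert_last v p)" if "v \<in> {1..Suc n}" for v
    using is_perm_insert_last[OF p that] .
  have ge1: "1 \<le> n" and len: "length p = n" using p by (auto simp: is_perm_def)
  have low_perm: "is_perm (Suc n) (insert_last g p)" if "g \<in> ?L" for g
    using low_less[OF p that] perm by auto
  define W' where "W' = (\<Sum>g\<in>?L. weight_A p g)"
  \<comment> \<open>Whatever the state of \<open>p\<close>, appending \<open>n + 1\<close> leads to
    the ascent state and appending \<open>n\<close> to the descent state; only the lower gaps need a
    case distinction.\<close>
  have rec: "?d (Suc t) p = geom4 t + 1 + coeff_asc t * Suc (card ?L) + coeff_weight t * (W' + Suc (card ?L))
      + (2 * geom4 t + 1 + geom4 t * card ?L) + (\<Sum>g\<in>?L. ?d t (insert_last g p))"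
    using descendants_Suc[of p n blocked_A t] asc[OF perm state_asc_A_top[OF p]]
      desc[OF perm state_desc_A_second[OF p]] len ge1 not_blocked_A_top[OF p]
    by (simp add: W'_def)
  show ?case
  proof (intro conjI impI)
    assume A: "state_asc_A p k W"
    then have kW: "card ?L = k" "W' = W" by (auto simp: state_asc_A_def W'_def)
    have "(\<Sum>g\<in>?L. ?d t (insert_last g p)) = (\<Sum>g\<in>?L. geom4 t + 1 + coeff_asc t * weight_A p g)"
      using asc[OF low_perm state_asc_A_low[OF p A]] by (intro sum.cong) auto
    also have "\<dots> = (geom4 t + 1) * k + coeff_asc t * W"
      using kW unfolding W'_def by (simp only: sum_affine)
    finally show "?d (Suc t) p = geom4 (Suc t) + 1 + coeff_asc (Suc t) * k + coeff_weight (Suc t) * W"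
      unfolding rec kW by (simp add: geom4_eq algebra_simps)
  next
    assume D: "state_desc_A p k"
    then obtain g R where L: "?L = insert g R" "\<forall>h\<in>R. h < g \<and> asc_above p h"
      "desc_above p g" "\<not> asc_above p g" "card R = k"
      unfolding state_desc_A_def by blast
    have "finite ?L" by simp
    then have R: "g \<notin> R" "finite R" using L(1,2) by auto
    then have card: "card ?L = Suc k" using L by simp
    have "weight_A p h = 0" if "h \<in> ?L" for h
      using L that desc_above_antimono[OF L(3)] by (auto simp: weight_A_def)
    then have "W' = 0" by (simp add: W'_def)
    have "(\<Sum>g\<in>?L. ?d t (insert_last g p)) = (2 * geom4 t + 1) * Suc k"
      using desc[OF low_perm state_desc_A_low[OF p D]] card by simp
    then show "?d (Suc t) p = 2 * geom4 (Suc t) + 1 + geom4 (Suc t) * k"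
      unfolding rec card \<open>W' = 0\<close> by (simp add: geom4_eq algebra_simps)
  qed
qed simp

text \<open>The coefficient of the total weight \<open>W\<close> in \<open>state_desc_B\<close> and
  \<open>state_desc321_B\<close>; the next two are those of \<open>k\<close> in
  \<open>state_asc231_B\<close> and \<open>state_desc231_B\<close>.\<close>

primrec coeff_desc_weight :: "nat \<Rightarrow> nat" where
  "coeff_desc_weight 0 = 0"
| "coeff_desc_weight (Suc t) = coeff_weight t + geom4 t"

primrec coeff_asc231 :: "nat \<Rightarrow> nat" where
  "coeff_asc231 0 = 0"
| "coeff_asc231 (Suc t) = geom4 t + 1 + coeff_asc t"

primrec coeff_desc231 :: "nat \<Rightarrow> nat" where
  "coeff_desc231 0 = 0"
| "coeff_desc231 (Suc t) = 2 * geom4 t + 1 + coeff_asc t"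

text \<open>Besides the child at \<open>n + 1\<close>, the weight of an ascent state is passed on by
  the lower children in the first class, but by these and the child at \<open>n\<close> in the
  second. The identity makes the two contributions agree.\<close>

lemma coeff_asc_eq: "coeff_asc t = coeff_asc231 t + coeff_desc_weight t"
  by (cases t) (auto simp: geom4_eq)

lemma coeff_desc231_eq: "coeff_desc231 t = coeff_asc231 t + coeff_weight t"
  by (cases t) auto

subsection \<open>Avoiding 3412, 4231, 45321 and 54312\<close>

definition blocked_B :: "nat list \<Rightarrow> nat \<Rightarrow> bool" where
  "blocked_B p g \<longleftrightarrow>
     blocked_3412 p g \<or> blocked_4231 p g \<or> blocked_45321 p g \<or> blocked_54312 p g"

text \<open>The added conditions come, in this order, from 4231, 45321, 3412 and 54312.\<close>

lemma blocked_B_insert_last: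
  "g \<le> v \<Longrightarrow> blocked_B (insert_last v p) g \<longleftrightarrow>
     blocked_B p g \<or> inv_across p g v \<or> above_231 p v"
  "v \<le> g \<Longrightarrow> blocked_B (insert_last v p) (Suc g) \<longleftrightarrow>
     blocked_B p g \<or> asc_above p g \<or> above_321 p g"
  unfolding blocked_B_def
  by (auto simp: blocked_3412_insert_last blocked_4231_insert_last
      blocked_45321_insert_last blocked_54312_insert_last)

definition weight_B :: "nat list \<Rightarrow> nat \<Rightarrow> nat" where
  "weight_B p g = (if above_231 p g then 0
     else card {h \<in> low blocked_B p. h \<le> g \<and> \<not> inv_across p h g})"

text \<open>Every permutation of the class is in one of the following five states.  Appending at a gap above
which 231 occurs blocks all lower gaps, which is why such gaps get weight 0.\<close>

definition state_asc_B :: "nat \<Rightarrow> nat list \<Rightarrow> nat \<Rightarrow> nat \<Rightarrow> bool" where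
  "state_asc_B n p k W \<longleftrightarrow> (\<forall>g\<in>low blocked_B p. asc_above p g \<and> \<not> inv_across p g n) \<and>
     card (low blocked_B p) = k \<and> (\<Sum>g\<in>low blocked_B p. weight_B p g) = W"

text \<open>Reached by inserting at a lower gap of an ascent state. All weights are 0, so
  \<open>k\<close> is the only parameter.\<close>

definition state_asc231_B :: "nat \<Rightarrow> nat list \<Rightarrow> nat \<Rightarrow> bool" where
  "state_asc231_B n p k \<longleftrightarrow> card (low blocked_B p) = k \<and>
     (\<forall>g\<in>low blocked_B p. asc_above p g \<and> above_231 p g \<and> inv_across p g n)"

text \<open>Common core of the three remaining states. With neither an ascent nor a 321 above it,
  the highest lower gap \<open>g\<close> survives, as \<open>Suc g\<close>, every insertion at a
  lower gap.\<close>

definition split_low :: "nat \<Rightarrow> nat list \<Rightarrow> nat \<Rightarrow> nat set \<Rightarrow> bool" where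
  "split_low n p g M \<longleftrightarrow> low blocked_B p = insert g M \<and> (\<forall>h\<in>M. h < g) \<and>
     (\<forall>h\<in>low blocked_B p. inv_across p h n) \<and> \<not> asc_above p g \<and> \<not> above_321 p g"

definition state_desc_B :: "nat \<Rightarrow> nat list \<Rightarrow> nat \<Rightarrow> nat \<Rightarrow> bool" where
  "state_desc_B n p k W \<longleftrightarrow> (\<exists>g R. split_low n p g R \<and>
     (\<forall>h\<in>R. asc_above p h \<and> \<not> inv_across p h g) \<and> card R = k \<and> (\<Sum>h\<in>R. weight_B p h) = W)"

definition state_desc231_B :: "nat \<Rightarrow> nat list \<Rightarrow> nat \<Rightarrow> bool" where
  "state_desc231_B n p k \<longleftrightarrow> (\<exists>g R. split_low n p g R \<and>
     (\<forall>h\<in>R. asc_above p h \<and> above_231 p h \<and> inv_across p h g) \<and> card R = k)"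

text \<open>Inserting at the highest gap of a \<open>split_low\<close> state leads here: its halves
  become \<open>g\<close> and \<open>g'\<close>, and the lower half has acquired a 321 above
  it.\<close>

definition state_desc321_B :: "nat \<Rightarrow> nat list \<Rightarrow> nat \<Rightarrow> nat \<Rightarrow> bool" where
  "state_desc321_B n p k W \<longleftrightarrow> (\<exists>g g' R. split_low n p g (insert g' R) \<and>
     \<not> asc_above p g' \<and> above_321 p g' \<and> inv_across p g' g \<and>
     (\<forall>h\<in>R. h < g' \<and> asc_above p h \<and> inv_across p h g \<and> \<not> inv_across p h g') \<and>
     card R = k \<and> (\<Sum>h\<in>R. weight_B p h) = W)"

text \<open>The smaller entry of the inversion lies either below \<open>x\<close> or at least at
  \<open>x\<close>.\<close>

lemma inv_across_split:
  "inv_across p h g \<Longrightarrow> x \<le> g \<Longrightarrow> inv_across p h x \<or> inv_across p x g"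
  unfolding inv_across_def by (meson le_trans not_le)

section \<open>Transitions between the states of the second class\<close>

context
  fixes p :: "nat list" and n :: nat
  assumes p: "is_perm n p"
begin

abbreviation (input) "low_B \<equiv> low blocked_B p"

lemmas inv_ins = inv_across_insert_last[OF set_p[OF p]]
lemmas ins_simps = asc_ins[OF p] inv_ins above_231_insert_last above_321_insert_last desc_ins[OF p]

lemma not_blocked_B_top: "n \<le> g \<Longrightarrow> \<not> blocked_B p g"
  using top_gaps[OF set_p[OF p]] by (auto simp: blocked_B_def)

lemma not_above_231_top: "n \<le> g \<Longrightarrow> \<not> above_231 p g"
  using not_asc_above_top[OF p] above_231_imp_asc_above by blast

lemma not_above_321_top: "n \<le> g \<Longrightarrow> \<not> above_321 p g"
  using not_desc_above_top[OF p] above_321_imp_desc_above by blast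

lemmas not_inv_top = not_inv_across_top[OF set_p[OF p]]

lemma low_B_top: "low blocked_B (insert_last (Suc n) p) = insert n low_B"
  using n_pos[OF p]
  by (auto simp: low_def len_p[OF p] blocked_B_insert_last not_blocked_B_top
      not_above_231_top not_inv_top)

text \<open>Only the maximum lies above the gap \<open>n\<close>, so \<open>inv_across p h n\<close>
  says that it precedes some smaller entry \<ge> \<open>h\<close>; such gaps get blocked by
  4231.\<close>

lemma low_B_second: "low blocked_B (insert_last n p) = insert n {h \<in> low_B. \<not> inv_across p h n}"
  using n_pos[OF p]
  by (auto simp: low_def len_p[OF p] blocked_B_insert_last not_blocked_B_top
      not_above_231_top not_inv_across_le)

lemma low_B_low:
  assumes "g \<in> low_B"
  shows "low blocked_B (insert_last g p) =
    {h \<in> low_B. h \<le> g \<and> \<not> inv_across p h g \<and> \<not> above_231 p g} \<union>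
    Suc ` {h \<in> low_B. g \<le> h \<and> \<not> asc_above p h \<and> \<not> above_321 p h}" (is "?l = ?r")
proof (rule set_eqI)
  fix x
  show "x \<in> ?l \<longleftrightarrow> x \<in> ?r"
  proof (cases "x \<le> g")
    case True
    then show ?thesis using low_less[OF p assms]
      by (auto simp: low_def len_p[OF p] blocked_B_insert_last)
  next
    case False
    then obtain y where "x = Suc y" "g \<le> y" by (cases x) auto
    then show ?thesis using low_less[OF p assms]
      by (auto simp: low_def len_p[OF p] blocked_B_insert_last)
  qed
qed

lemma state_asc_B_top:
  "state_asc_B (Suc n) (insert_last (Suc n) p) (Suc (card low_B))
     ((\<Sum>g\<in>low_B. weight_B p g) + Suc (card {g \<in> low_B. \<not> inv_across p g n}))"
proof -
  let ?q = "insert_last (Suc n) p"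
  have n: "n \<notin> low_B" using low_less[OF p] by blast
  have "weight_B ?q g = weight_B p g" if "g \<in> low_B" for g
  proof -
    have g: "1 \<le> g" "g < n" using low_less[OF p that] by auto
    then have "{h \<in> insert n low_B. h \<le> g \<and> \<not> inv_across ?q h g}
        = {h \<in> low_B. h \<le> g \<and> \<not> inv_across p h g}"
      by (auto simp: inv_ins)
    then show ?thesis using g
      by (simp add: weight_B_def above_231_insert_last not_asc_above_top[OF p] low_B_top
          del: insert_iff)
  qed
  moreover have "weight_B ?q n = Suc (card {g \<in> low_B. \<not> inv_across p g n})"
  proof -
    have "{h \<in> insert n low_B. h \<le> n \<and> \<not> inv_across ?q h n}
        = insert n {g \<in> low_B. \<not> inv_across p g n}"
      using low_less[OF p, of _ blocked_B]
      by (fastforce simp: inv_ins not_inv_across_le)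
    then show ?thesis using n
      by (simp add: weight_B_def above_231_insert_last not_asc_above_top[OF p]
          not_above_231_top low_B_top del: insert_iff)
  qed
  ultimately have "(\<Sum>g\<in>low blocked_B ?q. weight_B ?q g)
      = (\<Sum>g\<in>low_B. weight_B p g) + Suc (card {g \<in> low_B. \<not> inv_across p g n})"
    using n by (simp add: low_B_top)
  moreover have "asc_above ?q g \<and> \<not> inv_across ?q g (Suc n)" if "g \<in> low blocked_B ?q" for g
  proof -
    have "1 \<le> g" "g \<le> n" using that low_less[OF p, of g blocked_B] n_pos[OF p]
      by (auto simp: low_B_top)
    then show ?thesis by (simp add: ins_simps not_inv_top)
  qed
  ultimately show ?thesis using n by (simp add: state_asc_B_def low_B_top)
qed

text \<open>Exactly two entries lie above the gap \<open>n\<close>, the raised maximum and then the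
  new one. They form no ascent and no 321, but an inversion across each gap up to \<open>n\<close>
  and the gap \<open>n + 1\<close>.\<close>

lemma split_low_second:
  "split_low (Suc n) (insert_last n p) n {h \<in> low_B. \<not> inv_across p h n}"
proof -
  have "h < n" if "h \<in> low_B" for h using low_less[OF p that] by simp
  moreover have "inv_across (insert_last n p) h (Suc n)" if "h \<le> n" for h
    using that n_pos[OF p] by (simp add: inv_ins)
  moreover have "\<not> asc_above (insert_last n p) n" "\<not> above_321 (insert_last n p) n"
    using n_pos[OF p]
    by (simp_all add: ins_simps not_asc_above_top[OF p] not_above_321_top not_desc_above_top[OF p])
  ultimately show ?thesis
    unfolding split_low_def low_B_second by (metis (mono_tags, lifting) insertE less_imp_le_nat
      mem_Collect_eq order_refl)
qed

text \<open>In each of the five states either all lower gaps or none have an inversion across to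
  \<open>n\<close>, so this lemma and the next cover the child at \<open>n\<close>.\<close>

lemma state_desc_B_second_empty:
  assumes "\<forall>h\<in>low_B. inv_across p h n"
  shows "state_desc_B (Suc n) (insert_last n p) 0 0"
proof -
  have "{h \<in> low_B. \<not> inv_across p h n} = {}" using assms by blast
  then have "split_low (Suc n) (insert_last n p) n {}" using split_low_second by metis
  then show ?thesis unfolding state_desc_B_def by (intro exI[of _ n] exI[of _ "{}"]) simp
qed

lemma state_desc_B_second_full:
  assumes "\<forall>h\<in>low_B. \<not> inv_across p h n"
  shows "state_desc_B (Suc n) (insert_last n p) (card low_B) (\<Sum>g\<in>low_B. weight_B p g)"
proof -
  let ?q = "insert_last n p"
  have all_low: "{h \<in> low_B. \<not> inv_across p h n} = low_B" using assms by blast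
  then have split: "split_low (Suc n) ?q n low_B" using split_low_second by metis
  have "asc_above ?q g \<and> \<not> inv_across ?q g n \<and> weight_B ?q g = weight_B p g"
    if "g \<in> low_B" for g
  proof -
    have g: "1 \<le> g" "g < n" using low_less[OF p that] by auto
    then have "{h \<in> insert n low_B. h \<le> g \<and> \<not> inv_across ?q h g}
        = {h \<in> low_B. h \<le> g \<and> \<not> inv_across p h g}"
      by (auto simp: inv_ins)
    then have "weight_B ?q g = weight_B p g" using g
      by (simp add: weight_B_def above_231_insert_last not_asc_above_top[OF p] low_B_second all_low
          del: insert_iff)
    then show ?thesis using g that assms by (simp add: ins_simps)
  qed
  then show ?thesis unfolding state_desc_B_def using split
    by (intro exI[of _ n] exI[of _ low_B]) simp
qed

text \<open>An ascent above \<open>g\<close> and the new entry form a 231 above every survivor; gaps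
  above \<open>g\<close> are lost to their ascents.\<close>

lemma state_asc231_B_low:
  assumes "\<forall>h\<in>low_B. asc_above p h" "g \<in> low_B"
  shows "state_asc231_B (Suc n) (insert_last g p) (weight_B p g)"
proof -
  let ?q = "insert_last g p"
  have g: "1 \<le> g" "g < n" using low_less[OF p assms(2)] by auto
  have Lq: "low blocked_B ?q = {h \<in> low_B. h \<le> g \<and> \<not> inv_across p h g \<and> \<not> above_231 p g}"
    using assms(1) unfolding low_B_low[OF assms(2)] by blast
  have "asc_above ?q h \<and> above_231 ?q h \<and> inv_across ?q h (Suc n)" if "h \<in> low blocked_B ?q" for h
  proof -
    have "h \<in> low_B" "h \<le> g" using that unfolding Lq by auto
    then have "asc_above p h" "asc_above p g" "1 \<le> h"
      using assms low_less[OF p, of h blocked_B] by auto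
    then show ?thesis using g \<open>h \<le> g\<close> by (simp add: ins_simps)
  qed
  moreover have "card (low blocked_B ?q) = weight_B p g"
    unfolding Lq by (cases "above_231 p g") (simp_all add: weight_B_def)
  ultimately show ?thesis unfolding state_asc231_B_def by blast
qed

text \<open>From \<open>h\<close> upwards only \<open>g\<close> survives, and an ascent above
  \<open>h\<close> with the new entry gives a 231 above the lower survivors. The disjunction on
  \<open>M\<close> admits the gap \<open>g'\<close> of \<open>state_desc321_B\<close>.\<close>

lemma state_desc231_B_low:
  assumes split: "split_low n p g M" and M: "\<forall>h\<in>M. asc_above p h \<or> above_321 p h"
    and h: "h \<in> M" "asc_above p h"
  shows "state_desc231_B (Suc n) (insert_last h p) (weight_B p h)"
proof -
  let ?q = "insert_last h p"
  note s = split[unfolded split_low_def]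
  have hL: "h \<in> low_B" and gL: "g \<in> low_B" and hg: "h < g" using s h by auto
  have hn: "1 \<le> h" "h < n" "g < n" using low_less[OF p hL] low_less[OF p gL] by auto
  define R where "R = {x \<in> low_B. x \<le> h \<and> \<not> inv_across p x h \<and> \<not> above_231 p h}"
  have "{x \<in> low_B. h \<le> x \<and> \<not> asc_above p x \<and> \<not> above_321 p x} = {g}"
    using s M hg by auto
  then have Lq: "low blocked_B ?q = insert (Suc g) R"
    unfolding low_B_low[OF hL] R_def by simp
  have R: "x < Suc g \<and> inv_across ?q x (Suc n) \<and> asc_above ?q x \<and> above_231 ?q x
      \<and> inv_across ?q x (Suc g)" if "x \<in> R" for x
  proof -
    have "x \<le> h" "1 \<le> x" using that low_less[OF p, of x blocked_B] by (auto simp: R_def)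
    then show ?thesis using hn hg h(2) asc_above_antimono[OF h(2)] by (simp add: ins_simps)
  qed
  have "inv_across ?q (Suc g) (Suc n)" "\<not> asc_above ?q (Suc g)" "\<not> above_321 ?q (Suc g)"
    using s gL hg hn by (simp_all add: ins_simps)
  then have "split_low (Suc n) ?q (Suc g) R"
    unfolding split_low_def Lq using R by blast
  moreover have "card R = weight_B p h"
    unfolding R_def by (cases "above_231 p h") (simp_all add: weight_B_def)
  ultimately show ?thesis unfolding state_desc231_B_def using R by blast
qed

text \<open>Both halves of \<open>g\<close> survive; the lower one gets a 321 from a descent above
  \<open>g\<close> and the new entry. \<open>R\<close> is all of \<open>M\<close> in
  \<open>state_desc_B\<close> and empty in the other two states.\<close>

lemma state_desc321_B_top:
  assumes split: "split_low n p g M" and R: "R = {h \<in> M. \<not> inv_across p h g}"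
  shows "state_desc321_B (Suc n) (insert_last g p) (card R) (\<Sum>h\<in>R. weight_B p h)"
proof -
  let ?q = "insert_last g p"
  note s = split[unfolded split_low_def]
  have gL: "g \<in> low_B" and gM: "g \<notin> M" using s by auto
  have g: "1 \<le> g" "g < n" using low_less[OF p gL] by auto
  have t: "\<not> above_231 p g" using s above_231_imp_asc_above by blast
  have D: "desc_above p g" using s gL inv_across_imp_desc_above by blast
  have "{x \<in> low_B. g \<le> x \<and> \<not> asc_above p x \<and> \<not> above_321 p x} = {g}" using s by auto
  moreover have "{x \<in> low_B. x \<le> g \<and> \<not> inv_across p x g \<and> \<not> above_231 p g} = insert g R"
    using s t by (auto simp: R not_inv_across_le)
  ultimately have Lq: "low blocked_B ?q = insert (Suc g) (insert g R)"
    unfolding low_B_low[OF gL] by auto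
  have in_R: "x < g \<and> inv_across ?q x (Suc n) \<and> asc_above ?q x \<and> inv_across ?q x (Suc g)
      \<and> \<not> inv_across ?q x g \<and> weight_B ?q x = weight_B p x" if "x \<in> R" for x
  proof -
    have x: "x < g" "1 \<le> x" "\<not> inv_across p x g"
      using that s low_less[OF p, of x blocked_B] by (auto simp: R)
    \<comment> \<open>Every gap counted in the old weight of \<open>x\<close> lies in
      \<open>R\<close>: by \<open>inv_across_split\<close>, an inversion across \<open>h\<close> and
      \<open>g\<close> would give one across \<open>h\<close> and \<open>x\<close> or across
      \<open>x\<close> and \<open>g\<close>.\<close>
    have "{h \<in> insert (Suc g) (insert g R). h \<le> x \<and> \<not> inv_across ?q h x}
       = {h \<in> low_B. h \<le> x \<and> \<not> inv_across p h x}"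
      using x g s inv_across_split[of p _ g x] by (auto simp: R inv_ins)
    then have "weight_B ?q x = weight_B p x"
      using x g s by (simp add: weight_B_def above_231_insert_last Lq del: insert_iff)
    then show ?thesis using x g by (simp add: ins_simps)
  qed
  have "split_low (Suc n) ?q (Suc g) (insert g R)"
    unfolding split_low_def Lq using in_R s g gL by (auto simp: ins_simps intro: less_SucI)
  moreover have "\<not> asc_above ?q g" "above_321 ?q g" "inv_across ?q g (Suc g)"
    using s g D by (simp_all add: ins_simps)
  moreover have "(\<Sum>h\<in>R. weight_B ?q h) = (\<Sum>h\<in>R. weight_B p h)"
    using in_R by (intro sum.cong) auto
  ultimately show ?thesis unfolding state_desc321_B_def using in_R by blast
qed

text \<open>The upper half of \<open>g'\<close> is lost to its 321, the lower half and all of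
  \<open>R\<close> survive, and \<open>g\<close> becomes \<open>Suc g\<close>; the parameters do not
  change.\<close>

lemma state_desc321_B_low:
  assumes split: "split_low n p g (insert g' R)"
    and g': "\<not> asc_above p g'" "above_321 p g'" "inv_across p g' g"
    and R: "\<forall>h\<in>R. h < g' \<and> asc_above p h \<and> inv_across p h g \<and> \<not> inv_across p h g'"
  shows "state_desc321_B (Suc n) (insert_last g' p) (card R) (\<Sum>h\<in>R. weight_B p h)"
proof -
  let ?q = "insert_last g' p"
  note s = split[unfolded split_low_def]
  have gL: "g \<in> low_B" "g' \<in> low_B" and less: "g' < g" using s by auto
  have g: "1 \<le> g'" "g' < n" "g < n"
    using low_less[OF p gL(1)] low_less[OF p gL(2)] by auto
  have t: "\<not> above_231 p g'" using g' above_231_imp_asc_above by blast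
  have "{x \<in> low_B. g' \<le> x \<and> \<not> asc_above p x \<and> \<not> above_321 p x} = {g}"
    using s R less g' by auto
  moreover have "{x \<in> low_B. x \<le> g' \<and> \<not> inv_across p x g' \<and> \<not> above_231 p g'} = insert g' R"
    using s t R less by (auto simp: not_inv_across_le)
  ultimately have Lq: "low blocked_B ?q = insert (Suc g) (insert g' R)"
    unfolding low_B_low[OF gL(2)] by auto
  have in_R: "x < g' \<and> inv_across ?q x (Suc n) \<and> asc_above ?q x \<and> inv_across ?q x (Suc g)
      \<and> \<not> inv_across ?q x g' \<and> weight_B ?q x = weight_B p x" if "x \<in> R" for x
  proof -
    have x: "x < g'" "1 \<le> x" "\<not> inv_across p x g'"
      using that s R low_less[OF p, of x blocked_B] by auto
    have "{h \<in> insert (Suc g) (insert g' R). h \<le> x \<and> \<not> inv_across ?q h x}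
       = {h \<in> low_B. h \<le> x \<and> \<not> inv_across p h x}"
      using x g s less R by (auto simp: inv_ins)
    then have "weight_B ?q x = weight_B p x"
      using x g g' by (simp add: weight_B_def above_231_insert_last Lq del: insert_iff)
    then show ?thesis using x g less by (simp add: ins_simps)
  qed
  have "split_low (Suc n) ?q (Suc g) (insert g' R)"
    unfolding split_low_def Lq using in_R s g gL less by (auto simp: ins_simps)
  moreover have "\<not> asc_above ?q g'" "above_321 ?q g'" "inv_across ?q g' (Suc g)"
    using g g' less by (simp_all add: ins_simps)
  moreover have "(\<Sum>h\<in>R. weight_B ?q h) = (\<Sum>h\<in>R. weight_B p h)"
    using in_R by (intro sum.cong) auto
  ultimately show ?thesis unfolding state_desc321_B_def using in_R by blast
qed

end

section \<open>Counting descendants in the second class\<close>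

lemma descendants_B:
  assumes "is_perm n p"
  shows "(state_asc_B n p k W \<longrightarrow>
      descendants blocked_B t p = geom4 t + 1 + coeff_asc t * k + coeff_weight t * W) \<and>
    (state_asc231_B n p k \<longrightarrow>
      descendants blocked_B t p = geom4 t + 1 + coeff_asc231 t * k) \<and>
    (state_desc_B n p k W \<longrightarrow>
      descendants blocked_B t p = 2 * geom4 t + 1 + geom4 t * k + coeff_desc_weight t * W) \<and>
    (state_desc231_B n p k \<longrightarrow>
      descendants blocked_B t p = 2 * geom4 t + 1 + coeff_desc231 t * k) \<and>
    (state_desc321_B n p k W \<longrightarrow>
      descendants blocked_B t p = 3 * geom4 t + 1 + geom4 t * k + coeff_desc_weight t * W)"
  using assms
proof (induction t arbitrary: n p k W)
  case (Suc t)
  let ?L = "low blocked_B p" and ?d = "descendants blocked_B"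
  note p = \<open>is_perm n p\<close>
  have asc: "?d t q = geom4 t + 1 + coeff_asc t * j + coeff_weight t * V"
    if "is_perm (Suc n) q" "state_asc_B (Suc n) q j V" for q j V
    using Suc.IH that by blast
  have don: "?d t q = geom4 t + 1 + coeff_asc231 t * j"
    if "is_perm (Suc n) q" "state_asc231_B (Suc n) q j" for q j
    using Suc.IH that by blast
  have desc: "?d t q = 2 * geom4 t + 1 + geom4 t * j + coeff_desc_weight t * V"
    if "is_perm (Suc n) q" "state_desc_B (Suc n) q j V" for q j V
    using Suc.IH that by blast
  have desc_don: "?d t q = 2 * geom4 t + 1 + coeff_desc231 t * j"
    if "is_perm (Suc n) q" "state_desc231_B (Suc n) q j" for q j
    using Suc.IH that by blast
  have desc2: "?d t q = 3 * geom4 t + 1 + geom4 t * j + coeff_desc_weight t * V"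
    if "is_perm (Suc n) q" "state_desc321_B (Suc n) q j V" for q j V
    using Suc.IH that by blast
  have perm: "is_perm (Suc n) (insert_last v p)" if "v \<in> {1..Suc n}" for v
    using is_perm_insert_last[OF p that] .
  have ge1: "1 \<le> n" and len: "length p = n" using p by (auto simp: is_perm_def)
  have low_perm: "is_perm (Suc n) (insert_last g p)" if "g \<in> ?L" for g
    using low_less[OF p that] perm by auto
  define W' where "W' = (\<Sum>g\<in>?L. weight_B p g)"
  define m where "m = card {g \<in> ?L. \<not> inv_across p g n}"
  have rec: "?d (Suc t) p = geom4 t + 1 + coeff_asc t * Suc (card ?L) + coeff_weight t * (W' + Suc m)
      + ?d t (insert_last n p) + (\<Sum>g\<in>?L. ?d t (insert_last g p))"
    using descendants_Suc[of p n blocked_B t] asc[OF perm state_asc_B_top[OF p]]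
      len ge1 not_blocked_B_top[OF p]
    by (simp add: W'_def m_def)
  \<comment> \<open>Outside the ascent state the child at \<open>n\<close> keeps none of the old
    lower gaps, so its parameters are 0.\<close>
  have second: "?d t (insert_last n p) = 2 * geom4 t + 1" if "\<forall>h\<in>?L. inv_across p h n"
    using desc[OF perm state_desc_B_second_empty[OF p that]] ge1 by simp
  have m0: "m = 0" if "\<forall>h\<in>?L. inv_across p h n"
    using that by (simp add: m_def)
  show ?case
  proof (intro conjI impI)
    assume A: "state_asc_B n p k W"
    then have kW: "card ?L = k" "W' = W" by (auto simp: state_asc_B_def W'_def)
    have "{g \<in> ?L. \<not> inv_across p g n} = ?L" using A by (auto simp: state_asc_B_def)
    then have m: "m = k" by (simp add: m_def kW)
    have sec: "?d t (insert_last n p) = 2 * geom4 t + 1 + geom4 t * k + coeff_desc_weight t * W"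
      using desc[OF perm state_desc_B_second_full[OF p]] ge1 A kW by (simp add: state_asc_B_def W'_def)
    have "\<forall>g\<in>?L. asc_above p g" using A by (simp add: state_asc_B_def)
    then have "(\<Sum>g\<in>?L. ?d t (insert_last g p)) = (\<Sum>g\<in>?L. geom4 t + 1 + coeff_asc231 t * weight_B p g)"
      using don[OF low_perm state_asc231_B_low[OF p]] by (intro sum.cong) auto
    also have "\<dots> = (geom4 t + 1) * k + coeff_asc231 t * W"
      using kW unfolding W'_def by (simp only: sum_affine)
    finally show "?d (Suc t) p = geom4 (Suc t) + 1 + coeff_asc (Suc t) * k + coeff_weight (Suc t) * W"
      unfolding rec kW m sec by (simp add: geom4_eq coeff_asc_eq algebra_simps)
  next
    assume E: "state_asc231_B n p k"
    then have k: "card ?L = k" by (simp add: state_asc231_B_def)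
    have w: "weight_B p g = 0" if "g \<in> ?L" for g
      using E that by (auto simp: state_asc231_B_def weight_B_def)
    then have "W' = 0" by (simp add: W'_def)
    have inv: "\<forall>g\<in>?L. inv_across p g n" and "\<forall>g\<in>?L. asc_above p g"
      using E by (simp_all add: state_asc231_B_def)
    then have "(\<Sum>g\<in>?L. ?d t (insert_last g p)) = (\<Sum>g\<in>?L. geom4 t + 1)"
      using don[OF low_perm state_asc231_B_low[OF p]] w by (intro sum.cong) auto
    also have "\<dots> = k * (geom4 t + 1)" by (simp add: k)
    finally show "?d (Suc t) p = geom4 (Suc t) + 1 + coeff_asc231 (Suc t) * k"
      unfolding rec k m0[OF inv] second[OF inv] \<open>W' = 0\<close>
      by (simp add: geom4_eq algebra_simps)
  next
    assume D: "state_desc_B n p k W"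
    then obtain g R where split: "split_low n p g R" and
      R: "\<forall>h\<in>R. asc_above p h \<and> \<not> inv_across p h g" "card R = k" "(\<Sum>h\<in>R. weight_B p h) = W"
      unfolding state_desc_B_def by blast
    note s = split[unfolded split_low_def]
    have inv: "\<forall>h\<in>?L. inv_across p h n" and gR: "g \<notin> R" using s by auto
    have "finite ?L" by simp
    then have finR: "finite R" using s by simp
    \<comment> \<open>No inversion separates \<open>R\<close> from \<open>g\<close>, so the weight
      of \<open>g\<close> counts \<open>g\<close> and all of \<open>R\<close>.\<close>
    have "{h \<in> ?L. h \<le> g \<and> \<not> inv_across p h g} = insert g R"
      using s R by (auto simp: not_inv_across_le)
    then have "weight_B p g = Suc k"
      using s above_231_imp_asc_above[of p g] finR gR R by (auto simp: weight_B_def)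
    then have W': "W' = Suc k + W" and card: "card ?L = Suc k"
      using s R finR gR by (simp_all add: W'_def)
    have gL: "g \<in> ?L" and RL: "R \<subseteq> ?L" using s by auto
    have "{h \<in> R. \<not> inv_across p h g} = R" using R by blast
    then have g: "?d t (insert_last g p) = 3 * geom4 t + 1 + geom4 t * k + coeff_desc_weight t * W"
      using desc2[OF low_perm[OF gL] state_desc321_B_top[OF p split]] R by metis
    have "?d t (insert_last h p) = 2 * geom4 t + 1 + coeff_desc231 t * weight_B p h" if "h \<in> R" for h
      using desc_don[OF low_perm state_desc231_B_low[OF p split]] R RL that by blast
    then have "(\<Sum>h\<in>R. ?d t (insert_last h p)) = (\<Sum>h\<in>R. 2 * geom4 t + 1 + coeff_desc231 t * weight_B p h)"
      by (intro sum.cong) auto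
    also have "\<dots> = (2 * geom4 t + 1) * k + coeff_desc231 t * W"
      using R by (simp only: sum_affine)
    finally have sum: "(\<Sum>h\<in>?L. ?d t (insert_last h p))
        = 3 * geom4 t + 1 + geom4 t * k + coeff_desc_weight t * W + ((2 * geom4 t + 1) * k + coeff_desc231 t * W)"
      using s finR gR g by simp
    show "?d (Suc t) p = 2 * geom4 (Suc t) + 1 + geom4 (Suc t) * k + coeff_desc_weight (Suc t) * W"
      unfolding rec m0[OF inv] second[OF inv] W' card sum
      by (simp add: geom4_eq coeff_asc_eq coeff_desc231_eq algebra_simps)
  next
    assume D: "state_desc231_B n p k"
    then obtain g R where split: "split_low n p g R" and
      R: "\<forall>h\<in>R. asc_above p h \<and> above_231 p h \<and> inv_across p h g" "card R = k"
      unfolding state_desc231_B_def by blast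
    note s = split[unfolded split_low_def]
    have inv: "\<forall>h\<in>?L. inv_across p h n" and gR: "g \<notin> R" using s by auto
    have "finite ?L" by simp
    then have finR: "finite R" using s by simp
    \<comment> \<open>Here every gap of \<open>R\<close> is cut off from \<open>g\<close>, which
      counts only itself.\<close>
    have "{h \<in> ?L. h \<le> g \<and> \<not> inv_across p h g} = {g}"
      using s R by (auto simp: not_inv_across_le)
    then have "weight_B p g = 1"
      using s above_231_imp_asc_above[of p g] by (auto simp: weight_B_def)
    moreover have w: "weight_B p h = 0" if "h \<in> R" for h
      using R that by (simp add: weight_B_def)
    ultimately have W': "W' = 1" and card: "card ?L = Suc k"
      using s R finR gR by (simp_all add: W'_def)
    have gL: "g \<in> ?L" and RL: "R \<subseteq> ?L" using s by auto
    have none: "{} = {h \<in> R. \<not> inv_across p h g}" using R by blast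
    then have g: "?d t (insert_last g p) = 3 * geom4 t + 1"
      using desc2[OF low_perm[OF gL] state_desc321_B_top[OF p split none]] by simp
    have "?d t (insert_last h p) = 2 * geom4 t + 1" if "h \<in> R" for h
    proof -
      have "state_desc231_B (Suc n) (insert_last h p) 0"
        using state_desc231_B_low[OF p split _ that] R that w[OF that] by simp
      then show ?thesis using desc_don[OF low_perm] RL that by fastforce
    qed
    then have "(\<Sum>h\<in>?L. ?d t (insert_last h p)) = 3 * geom4 t + 1 + (2 * geom4 t + 1) * k"
      using s finR gR g R by simp
    then show "?d (Suc t) p = 2 * geom4 (Suc t) + 1 + coeff_desc231 (Suc t) * k"
      unfolding rec m0[OF inv] second[OF inv] W' card
      by (simp add: geom4_eq algebra_simps)
  next
    assume D: "state_desc321_B n p k W"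
    then obtain g g' R where split: "split_low n p g (insert g' R)"
      and g': "\<not> asc_above p g'" "above_321 p g'" "inv_across p g' g"
      and R: "\<forall>h\<in>R. h < g' \<and> asc_above p h \<and> inv_across p h g \<and> \<not> inv_across p h g'"
      and kW: "card R = k" "(\<Sum>h\<in>R. weight_B p h) = W"
      unfolding state_desc321_B_def by blast
    note s = split[unfolded split_low_def]
    have inv: "\<forall>h\<in>?L. inv_across p h n" and gR: "g \<notin> insert g' R" "g' \<notin> R"
      using s R by auto
    have "finite ?L" by simp
    then have finR: "finite R" using s by simp
    have "{h \<in> ?L. h \<le> g \<and> \<not> inv_across p h g} = {g}"
      using s R g' by (auto simp: not_inv_across_le)
    then have wg: "weight_B p g = 1"
      using s above_231_imp_asc_above[of p g] by (auto simp: weight_B_def)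
    \<comment> \<open>Although \<open>R\<close> is cut off from \<open>g\<close>, it is not cut off
      from \<open>g'\<close>.\<close>
    have "{h \<in> ?L. h \<le> g' \<and> \<not> inv_across p h g'} = insert g' R"
      using s R by (auto simp: not_inv_across_le)
    then have "weight_B p g' = Suc k"
      using g' above_231_imp_asc_above[of p g'] finR gR kW by (auto simp: weight_B_def)
    then have W': "W' = k + W + 2" and card: "card ?L = k + 2"
      using s kW finR gR wg by (simp_all add: W'_def)
    have gL: "g \<in> ?L" and gL': "g' \<in> ?L" and RL: "R \<subseteq> ?L" using s by auto
    have none: "{} = {h \<in> insert g' R. \<not> inv_across p h g}" using R g' by blast
    then have g: "?d t (insert_last g p) = 3 * geom4 t + 1"
      using desc2[OF low_perm[OF gL] state_desc321_B_top[OF p split none]] by simp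
    have dg': "?d t (insert_last g' p) = 3 * geom4 t + 1 + geom4 t * k + coeff_desc_weight t * W"
      using desc2[OF low_perm[OF gL'] state_desc321_B_low[OF p split g' R]] kW by simp
    have "?d t (insert_last h p) = 2 * geom4 t + 1 + coeff_desc231 t * weight_B p h" if "h \<in> R" for h
      using desc_don[OF low_perm state_desc231_B_low[OF p split]] R g' RL that by blast
    then have "(\<Sum>h\<in>R. ?d t (insert_last h p)) = (\<Sum>h\<in>R. 2 * geom4 t + 1 + coeff_desc231 t * weight_B p h)"
      by (intro sum.cong) auto
    also have "\<dots> = (2 * geom4 t + 1) * k + coeff_desc231 t * W"
      using kW by (simp only: sum_affine)
    finally have sum: "(\<Sum>h\<in>?L. ?d t (insert_last h p)) = 3 * geom4 t + 1
        + (3 * geom4 t + 1 + geom4 t * k + coeff_desc_weight t * W + ((2 * geom4 t + 1) * k + coeff_desc231 t * W))"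
      using s finR gR g dg' by simp
    show "?d (Suc t) p = 3 * geom4 (Suc t) + 1 + geom4 (Suc t) * k + coeff_desc_weight (Suc t) * W"
      unfolding rec m0[OF inv] second[OF inv] W' card sum
      by (simp add: geom4_eq coeff_asc_eq coeff_desc231_eq algebra_simps)
  qed
qed simp

theorem corollary5p1:
  fixes n :: nat
  assumes "n \<ge> 1"
  shows "card (Av n {[3,4,1,2], [4,3,2,1]})
       = card (Av n {[3,4,1,2], [4,2,3,1], [4,5,3,2,1], [5,4,3,1,2]})"
proof -
  obtain t where n: "n = Suc t" using assms by (cases n) auto
  have perm: "is_perm 1 [1]" by (simp add: is_perm_def)
  have low: "low bl [1] = {}" for bl by (simp add: low_def)
  have top: "\<not> blocked_A [] 1" "\<not> blocked_B [] 1"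
    by (auto simp: blocked_A_def blocked_B_def above_defs blocked_3412_def blocked_4231_def
        blocked_45321_def blocked_54312_def)
  have "card (Av n {[3,4,1,2], [4,3,2,1]}) = descendants blocked_A t [1]"
    unfolding n by (rule card_Av_Suc)
      (use top in \<open>auto simp: contains_3412_insert_last contains_4321_insert_last blocked_A_def
        simp del: One_nat_def\<close>)
  \<comment> \<open>In both classes [1] has no lower gap, hence is in the ascent state with k = W =
    0.\<close>
  also have "\<dots> = geom4 t + 1"
    using descendants_A[OF perm, of 0 0 t] by (simp add: state_asc_A_def low del: One_nat_def)
  also have "\<dots> = descendants blocked_B t [1]"
    using descendants_B[OF perm, of 0 0 t] by (simp add: state_asc_B_def low del: One_nat_def)
  also have "\<dots> = card (Av n {[3,4,1,2], [4,2,3,1], [4,5,3,2,1], [5,4,3,1,2]})"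
    unfolding n by (rule card_Av_Suc[symmetric])
      (use top in \<open>auto simp: contains_3412_insert_last contains_4231_insert_last
        contains_45321_insert_last contains_54312_insert_last blocked_B_def
        simp del: One_nat_def\<close>)
  finally show ?thesis .
qed

end
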